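(* Let $G$ be a connected graph of diameter $D$ and let $W=\{w_1,\dots,w_k\}\subseteq V(G)$. Then $W$ is a strong resolving set for some graph $H\in\mathcal{U}(G)$ if and only if there is a $W$-resolved embedding $\varphi$ of $G$ in $P_{D+1}^{\boxtimes,k}$ such that $\varphi(G)$ is an isometric subgraph of $P_{D+1}^{\boxtimes,k}$.
   Context: For vertices $u,v,w$ of a connected graph $G$, $w$ strongly resolves $u$ and $v$ if there is a shortest $u$-$w$ path containing $v$ or a shortest $v$-$w$ path containing $u$. A set $W\subseteq V(G)$ is a strong resolving set of $G$ if every pair of vertices of $G$ is strongly resolved by some vertex of $W$. $\mathcal{U}(G)$ denotes the family of graphs having $G$ as a spanning subgraph. $P_n$ denotes the path with vertex set $\{0,1,\dots,n-1\}$, where $i$ and $i+1$ are adjacent. The strong product $G_1\boxtimes\cdots\boxtimes G_k$ has vertex set $V(G_1)\times\cdots\times V(G_k)$, two distinct vertices being adjacent iff in every coordinate they are equal or adjacent; $G^{\boxtimes,k}$ is the strong product of $k$ copies of $G$, so in $P_n^{\boxtimes,k}$, $d(x,y)=\max_i|x_i-y_i|$. An embedding of $G$ in $H$ is an injective map $\varphi:V(G)\to V(H)$ with $xy\in E(G)\Rightarrow\varphi(x)\varphi(y)\in E(H)$; $\varphi(G)$ is the subgraph of $H$ induced by $\varphi(V(G))$. A $W$-resolved embedding of $G$ in $P^{\boxtimes,k}$ is an embedding $\varphi$ such that for every $x\in V(G)$, $\varphi(x)=\big(d_{\varphi(G)}(\varphi(x),\varphi(w_1)),\dots,d_{\varphi(G)}(\varphi(x),\varphi(w_k))\big)$.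 A subgraph $G'$ of $H$ is isometric if $d_{G'}(u,v)=d_H(u,v)$ for all $u,v\in V(G')$. *)

theory Defs
  imports "Graph_Theory.Graph_Theory"
begin

text \<open>
  A simple undirected graph is a symmetric loop-free digraph without parallel arcs,
  i.e. a \<open>'a pair_pre_digraph\<close> satisfying \<^locale>\<open>pair_bidirected_digraph\<close>; finiteness is not
  required. The library notions (subgraphs, connectedness, walks, \<open>\<mu>\<close>) live on \<open>pre_digraph\<close>,
  reached through the coercion \<^const>\<open>with_proj\<close>.
\<close>

text \<open>Unit weights turn the library's weighted distance into the number of edges of a
  shortest walk (infinite if there is none).\<close>

definition gdist :: "('a, 'b) pre_digraph \<Rightarrow> 'a \<Rightarrow> 'a \<Rightarrow> ereal" where
  "gdist G u v = wf_digraph.\<mu> G (\<lambda>_. 1) u v"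

definition graph_diameter :: "('a, 'b) pre_digraph \<Rightarrow> ereal" where
  "graph_diameter G = (SUP (u, v) \<in> verts G \<times> verts G. gdist G u v)"

definition shortest_path :: "('a, 'b) pre_digraph \<Rightarrow> 'a \<Rightarrow> 'b awalk \<Rightarrow> 'a \<Rightarrow> bool" where
  "shortest_path G u p v \<longleftrightarrow>
     pre_digraph.apath G u p v \<and> ereal (real (length p)) = gdist G u v"

definition strongly_resolves :: "('a, 'b) pre_digraph \<Rightarrow> 'a \<Rightarrow> 'a \<Rightarrow> 'a \<Rightarrow> bool" where
  "strongly_resolves G w u v \<longleftrightarrow>
     (\<exists>p. shortest_path G u p w \<and> v \<in> set (pre_digraph.awalk_verts G u p)) \<or>
     (\<exists>p. shortest_path G v p w \<and> u \<in> set (pre_digraph.awalk_verts G v p))"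

definition strong_resolving_set :: "('a, 'b) pre_digraph \<Rightarrow> 'a set \<Rightarrow> bool" where
  "strong_resolving_set G W \<longleftrightarrow>
     W \<subseteq> verts G \<and>
     (\<forall>u \<in> verts G. \<forall>v \<in> verts G. u \<noteq> v \<longrightarrow> (\<exists>w \<in> W. strongly_resolves G w u v))"

text \<open>The family \<open>\<U>(G)\<close> of graphs having \<open>G\<close> as a spanning subgraph.\<close>

definition spanning_supergraphs :: "'a pair_pre_digraph \<Rightarrow> 'a pair_pre_digraph set" where
  "spanning_supergraphs G =
     {H. pair_bidirected_digraph H \<and> spanning (with_proj G) (with_proj H)}"

definition path_graph :: "nat \<Rightarrow> nat pair_pre_digraph" where
  "path_graph n =
     \<lparr> pverts = {0..<n},
       parcs = {(i, j). i < n \<and> j < n \<and> (j = i + 1 \<or> i = j + 1)} \<rparr>"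

text \<open>Vertices of a product of \<open>k\<close> graphs are lists of length \<open>k\<close>; for \<open>k = 0\<close> the product is
  the one-vertex graph.\<close>

definition strong_product :: "'a pair_pre_digraph list \<Rightarrow> 'a list pair_pre_digraph" where
  "strong_product Gs =
     (let V = {x. length x = length Gs \<and> (\<forall>i < length Gs. x ! i \<in> pverts (Gs ! i))}
      in \<lparr> pverts = V,
           parcs = {(x, y). x \<in> V \<and> y \<in> V \<and> x \<noteq> y \<and>
             (\<forall>i < length Gs. x ! i = y ! i \<or> (x ! i, y ! i) \<in> parcs (Gs ! i))} \<rparr>)"

definition strong_power :: "'a pair_pre_digraph \<Rightarrow> nat \<Rightarrow> 'a list pair_pre_digraph" where
  "strong_power G k = strong_product (replicate k G)"

definition graph_embedding ::
    "('a \<Rightarrow> 'b) \<Rightarrow> 'a pair_pre_digraph \<Rightarrow> 'b pair_pre_digraph \<Rightarrow> bool" where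
  "graph_embedding \<phi> G H \<longleftrightarrow>
     \<phi> ` pverts G \<subseteq> pverts H \<and> inj_on \<phi> (pverts G) \<and>
     (\<forall>x y. (x, y) \<in> parcs G \<longrightarrow> (\<phi> x, \<phi> y) \<in> parcs H)"

text \<open>The image \<open>\<phi>(G)\<close> is the \<^emph>\<open>induced\<close> subgraph of \<open>H\<close>; it may have more edges than \<open>G\<close>.\<close>

definition embedding_image ::
    "('a \<Rightarrow> 'b) \<Rightarrow> 'a pair_pre_digraph \<Rightarrow> 'b pair_pre_digraph \<Rightarrow> ('b, 'b \<times> 'b) pre_digraph" where
  "embedding_image \<phi> G H = with_proj H \<restriction> (\<phi> ` pverts G)"

text \<open>The list \<open>ws\<close> is the enumeration \<open>w\<^sub>1, \<dots>, w\<^sub>k\<close> of \<open>W\<close> that orders the coordinates.\<close>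

definition resolved_embedding ::
    "'a list \<Rightarrow> ('a \<Rightarrow> nat list) \<Rightarrow> 'a pair_pre_digraph \<Rightarrow> nat list pair_pre_digraph \<Rightarrow> bool" where
  "resolved_embedding ws \<phi> G P \<longleftrightarrow>
     graph_embedding \<phi> G P \<and>
     (\<forall>x \<in> pverts G.
        map (\<lambda>n. ereal (real n)) (\<phi> x) =
        map (\<lambda>w. gdist (embedding_image \<phi> G P) (\<phi> x) (\<phi> w)) ws)"

definition isometric_subgraph :: "('a, 'b) pre_digraph \<Rightarrow> ('a, 'b) pre_digraph \<Rightarrow> bool" where
  "isometric_subgraph G' H \<longleftrightarrow>
     subgraph G' H \<and> (\<forall>u \<in> verts G'. \<forall>v \<in> verts G'. gdist G' u v = gdist H u v)"

end

(* If W strongly resolves H, the map x |-> (d_H(x,w))_w is distance preserving into the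
   max-metric on tuples, since each coordinate is 1-Lipschitz, and a vertex w that strongly resolves
   x and y gives |d_H(x,w) - d_H(y,w)| = d_H(x,y). Conversely an isometric resolved embedding
   phi is pulled back along itself to a supergraph H of G; since d_H is then the maximum of
   the coordinate differences |d_H(x,w) - d_H(y,w)|, a coordinate that attains the maximum
   strongly resolves x and y. *)

theory Submission
  imports Defs
begin

section \<open>Distances counted in edges\<close>

context wf_digraph
begin

lemma awalk_cost_unit: "awalk_cost (\<lambda>_. 1) p = real (length p)"
  by (induct p) auto

lemma gdist_le_length:
  assumes "awalk u p v"
  shows "gdist G u v \<le> ereal (real (length p))"
  using min_cost_le_walk_cost[OF assms, of "\<lambda>_. 1"]
  by (simp add: gdist_def awalk_cost_unit)

lemma gdist_greatest:
  assumes "\<And>p. awalk u p v \<Longrightarrow> c \<le> ereal (real (length p))"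
  shows "c \<le> gdist G u v"
  unfolding gdist_def \<mu>_def using assms by (auto intro!: INF_greatest simp: awalk_cost_unit)

text \<open>Walk lengths are natural numbers, so among the walks from \<open>u\<close> to
  \<open>v\<close> one has least length, and finiteness of the distance guarantees that a walk
  exists.\<close>

lemma gdist_attained:
  assumes "gdist G u v < \<infinity>"
  obtains p where "awalk u p v" "gdist G u v = ereal (real (length p))"
proof -
  from assms have "\<exists>p. awalk u p v"
    by (simp only: gdist_def \<mu>_reach_conv reachable_awalk)
  then obtain p where p: "awalk u p v" "\<And>q. awalk u q v \<Longrightarrow> length p \<le> length q"
    using ex_has_least_nat[of "\<lambda>p. awalk u p v" _ length] by blast
  then have "gdist G u v = ereal (real (length p))"
    by (intro antisym gdist_le_length gdist_greatest) auto
  with p(1) show thesis by (rule that)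
qed

lemma gdist_self:
  assumes "u \<in> verts G"
  shows "gdist G u u = 0"
proof (rule antisym)
  show "gdist G u u \<le> 0"
    using gdist_le_length[of u "[]" u] assms by (simp add: awalk_Nil_iff zero_ereal_def)
qed (auto intro: gdist_greatest)

lemma gdist_arc:
  assumes "a \<in> arcs G"
  shows "gdist G (tail G a) (head G a) \<le> 1"
  using gdist_le_length[OF arc_implies_awalk[OF assms]] by (simp add: one_ereal_def)

lemma gdist_triangle: "gdist G u w \<le> gdist G u v + gdist G v w"
proof (cases "gdist G u v < \<infinity> \<and> gdist G v w < \<infinity>")
  case True
  obtain p where "awalk u p v" "gdist G u v = ereal (real (length p))"
    using True by (elim conjE gdist_attained)
  moreover obtain q where "awalk v q w" "gdist G v w = ereal (real (length q))"
    using True by (elim conjE gdist_attained)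
  ultimately show ?thesis
    using gdist_le_length[of u "p @ q" w] awalk_appendI[of u p v q w] by simp
qed auto

text \<open>A walk that repeats a vertex contains a nonempty closed segment; cutting it out leaves a
  shorter walk with the same ends. Hence a walk of minimal length is a path.\<close>

lemma shortest_path_iff:
  "shortest_path G u p v \<longleftrightarrow> awalk u p v \<and> ereal (real (length p)) = gdist G u v"
proof
  assume R: "awalk u p v \<and> ereal (real (length p)) = gdist G u v"
  have "distinct (awalk_verts u p)"
  proof (rule ccontr)
    assume "\<not> distinct (awalk_verts u p)"
    from awalk_not_distinct_decomp[OF _ this] R
    obtain q r s w where "p = q @ r @ s" "0 < length r" "awalk u q w" "awalk w s v"
      by (elim conjE exE) (metis (no_types))
    have "gdist G u v \<le> ereal (real (length (q @ s)))"
      using \<open>awalk u q w\<close> \<open>awalk w s v\<close> by (intro gdist_le_length awalk_appendI)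
    then have "length p \<le> length (q @ s)"
      using R by (metis ereal_less_eq(3) of_nat_le_iff)
    then show False
      using \<open>p = q @ r @ s\<close> \<open>0 < length r\<close> by simp
  qed
  with R show "shortest_path G u p v"
    by (simp add: shortest_path_def apath_def)
qed (simp add: shortest_path_def apath_def)

text \<open>A shortest path splits at \<open>v\<close> into two walks, and shortest walks through
  \<open>v\<close> can be concatenated, so the condition is equality in the triangle inequality. The
  finiteness clause rules out \<open>\<infinity> = \<infinity>\<close>, an equality that no path
  witnesses.\<close>

lemma shortest_path_through_iff:
  "(\<exists>p. shortest_path G u p w \<and> v \<in> set (awalk_verts u p)) \<longleftrightarrow>
    gdist G u v + gdist G v w = gdist G u w \<and> gdist G u w < \<infinity>" (is "?L \<longleftrightarrow> ?R")
proof
  assume ?L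
  then obtain p where p: "awalk u p w" "ereal (real (length p)) = gdist G u w"
    "v \<in> set (awalk_verts u p)"
    by (auto simp: shortest_path_iff)
  then obtain q r where qr: "p = q @ r" "awalk u q v" "awalk v r w"
    using awalk_decomp by blast
  have "gdist G u v + gdist G v w \<le> ereal (real (length q)) + ereal (real (length r))"
    using qr by (intro add_mono gdist_le_length)
  also have "\<dots> = gdist G u w" using p(2) qr(1) by simp
  finally show ?R
    using p(2) gdist_triangle[of u w v]
    by (metis antisym ereal_less_PInfty ereal_infty_less(1) PInfty_neq_ereal(1))
next
  assume R: ?R
  have fin: "gdist G u v < \<infinity> \<and> gdist G v w < \<infinity>"
    using R by (cases "gdist G u v"; cases "gdist G v w") auto
  obtain p where "awalk u p v" "gdist G u v = ereal (real (length p))"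
    using fin by (elim conjE gdist_attained)
  moreover obtain q where "awalk v q w" "gdist G v w = ereal (real (length q))"
    using fin by (elim conjE gdist_attained)
  ultimately have "shortest_path G u (p @ q) w \<and> v \<in> set (awalk_verts u (p @ q))"
    using R awalk_appendI[of u p v q w]
    by (auto simp: shortest_path_iff set_awalk_verts_append)
  then show ?L by blast
qed

text \<open>Strong resolution becomes a statement about distances alone, so that both directions of
  the theorem can argue without paths.\<close>

lemma strongly_resolves_iff:
  "strongly_resolves G w u v \<longleftrightarrow>
    gdist G u v + gdist G v w = gdist G u w \<and> gdist G u w < \<infinity> \<or>
    gdist G v u + gdist G u w = gdist G v w \<and> gdist G v w < \<infinity>"
  unfolding strongly_resolves_def shortest_path_through_iff ..

text \<open>The change of \<open>f\<close> along a walk is at most the number of its arcs. This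
  yields lower bounds for distances in the strong power, with a coordinate as
  \<open>f\<close>.\<close>

lemma lipschitz_le_gdist:
  fixes f :: "'a \<Rightarrow> real"
  assumes "\<And>a. a \<in> arcs G \<Longrightarrow> \<bar>f (tail G a) - f (head G a)\<bar> \<le> 1"
  shows "ereal \<bar>f u - f v\<bar> \<le> gdist G u v"
proof (rule gdist_greatest)
  fix p assume "awalk u p v"
  then have "\<bar>f u - f v\<bar> \<le> real (length p)"
  proof (induct p arbitrary: u)
    case Nil
    then show ?case by (simp add: awalk_Nil_iff)
  next
    case (Cons a p)
    then have "\<bar>f (head G a) - f v\<bar> \<le> real (length p)" "\<bar>f u - f (head G a)\<bar> \<le> 1"
      using assms by (auto simp: awalk_Cons_iff)
    then show ?case by simp
  qed
  then show "ereal \<bar>f u - f v\<bar> \<le> ereal (real (length p))" by simp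
qed

end

text \<open>A homomorphism carries walks to walks of the same length. If no walk joins
  \<open>u\<close> to \<open>v\<close>, the right-hand side is infinite, so \<open>u\<close> and
  \<open>v\<close> may be arbitrary.\<close>

lemma gdist_hom_le:
  assumes "wf_digraph G" "wf_digraph H"
    and verts: "\<And>x. x \<in> verts G \<Longrightarrow> f x \<in> verts H"
    and arcs: "\<And>a. a \<in> arcs G \<Longrightarrow>
      \<exists>b \<in> arcs H. tail H b = f (tail G a) \<and> head H b = f (head G a)"
  shows "gdist H (f u) (f v) \<le> gdist G u v"
proof -
  interpret G: wf_digraph G by fact
  interpret H: wf_digraph H by fact
  have *: "\<exists>q. H.awalk (f u) q (f v) \<and> length q = length p" if "G.awalk u p v" for p
    using that
  proof (induct p arbitrary: u)
    case Nil
    then show ?case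
      by (intro exI[of _ "[]"]) (auto simp: G.awalk_Nil_iff H.awalk_Nil_iff verts)
  next
    case (Cons a p)
    then obtain q where q: "H.awalk (f (head G a)) q (f v)" "length q = length p"
      by (auto simp: G.awalk_Cons_iff)
    from Cons.prems obtain b where "b \<in> arcs H" "tail H b = f u" "head H b = f (head G a)"
      using arcs[of a] by (auto simp: G.awalk_Cons_iff)
    with q show ?case
      by (intro exI[of _ "b # q"]) (auto simp: H.awalk_Cons_iff)
  qed
  show ?thesis
    by (rule G.gdist_greatest) (metis * H.gdist_le_length)
qed

lemma (in pair_sym_digraph) gdist_sym: "gdist (with_proj G) u v = gdist (with_proj G) v u"
proof -
  have length_rev: "length (rev_path p) = length p" for p :: "('a \<times> 'a) list"
    by (induct p) auto
  have "gdist (with_proj G) v u \<le> gdist (with_proj G) u v" for u v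
    by (rule gdist_greatest) (metis awalk_rev_path gdist_le_length length_rev)
  then show ?thesis by (simp add: antisym)
qed

section \<open>Strong powers of paths\<close>

lemma pverts_path_power:
  "pverts (strong_power (path_graph n) k) = {x. length x = k \<and> (\<forall>i<k. x ! i < n)}"
  by (auto simp: strong_power_def strong_product_def path_graph_def)

text \<open>Two natural numbers are equal or consecutive iff their real difference is at most 1 in
  absolute value. Real differences avoid truncated subtraction and match the Lipschitz
  bound.\<close>

lemma parcs_path_power:
  "(x, y) \<in> parcs (strong_power (path_graph n) k) \<longleftrightarrow>
    x \<in> pverts (strong_power (path_graph n) k) \<and> y \<in> pverts (strong_power (path_graph n) k) \<and>
    x \<noteq> y \<and> (\<forall>i<k. \<bar>real (x ! i) - real (y ! i)\<bar> \<le> 1)"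
proof -
  have "i < n \<Longrightarrow> j < n \<Longrightarrow>
    (i = j \<or> (i, j) \<in> parcs (path_graph n)) \<longleftrightarrow> \<bar>real i - real j\<bar> \<le> 1" for i j
    by (auto simp: path_graph_def)
  then show ?thesis
    by (auto simp: pverts_path_power strong_power_def strong_product_def path_graph_def)
qed

lemma wf_path_power: "wf_digraph (with_proj (strong_power (path_graph n) k))"
  by unfold_locales (auto simp: parcs_path_power)

lemma gdist_path_power_ge:
  assumes "i < k"
  shows "ereal \<bar>real (x ! i) - real (y ! i)\<bar>
    \<le> gdist (with_proj (strong_power (path_graph n) k)) x y"
  using wf_digraph.lipschitz_le_gdist[OF wf_path_power, where f = "\<lambda>x. real (x ! i)"] assms
  by (auto simp: parcs_path_power)

text \<open>In a strong product all coordinates can move at once, like a king on a chessboard, so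
  the largest coordinate difference bounds the number of steps.\<close>

lemma gdist_path_power_le:
  assumes "x \<in> pverts (strong_power (path_graph n) k)"
    and "y \<in> pverts (strong_power (path_graph n) k)"
    and "\<And>i. i < k \<Longrightarrow> \<bar>real (x ! i) - real (y ! i)\<bar> \<le> real m"
  shows "gdist (with_proj (strong_power (path_graph n) k)) x y \<le> ereal (real m)"
  using assms
proof (induct m arbitrary: x)
  case 0
  then have "x = y"
    by (auto simp: pverts_path_power intro: nth_equalityI)
  then show ?case
    using wf_digraph.gdist_self[OF wf_path_power] 0 by simp
next
  case (Suc m)
  let ?P = "with_proj (strong_power (path_graph n) k)"
  \<comment> \<open>Every coordinate of \<open>x\<close> that differs from that of \<open>y\<close>
    moves one unit towards it. Thus \<open>z\<close> stays inside the grid and each positive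
    difference drops by one.\<close>
  define z where "z = map (\<lambda>i. if x ! i < y ! i then x ! i + 1
    else if y ! i < x ! i then x ! i - 1 else x ! i) [0..<k]"
  have z_nth: "z ! i = (if x ! i < y ! i then x ! i + 1
    else if y ! i < x ! i then x ! i - 1 else x ! i)" if "i < k" for i
    using that by (simp add: z_def)
  have z: "z \<in> verts ?P"
    unfolding with_proj_simps pverts_path_power mem_Collect_eq
  proof (intro conjI allI impI)
    show "length z = k" by (simp add: z_def)
    fix i assume i: "i < k"
    then have "x ! i < n" "y ! i < n" using Suc.prems by (auto simp: pverts_path_power)
    then show "z ! i < n" by (auto simp: z_nth i)
  qed
  have xz: "\<bar>real (x ! i) - real (z ! i)\<bar> \<le> 1" if "i < k" for i
    by (auto simp: z_nth that of_nat_diff)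
  have zy: "\<bar>real (z ! i) - real (y ! i)\<bar> \<le> real m" if "i < k" for i
    using Suc.prems(3)[OF that] by (auto simp: z_nth that of_nat_diff abs_if split: if_splits)
  have "gdist ?P z y \<le> ereal (real m)"
    using z Suc.prems(2) zy by (intro Suc.hyps) auto
  \<comment> \<open>\<open>z\<close> coincides with \<open>x\<close> when \<open>x = y\<close>, and
    the product has no loops, so this case is split off.\<close>
  moreover have "gdist ?P x z \<le> 1"
  proof (cases "x = z")
    case True
    then show ?thesis using wf_digraph.gdist_self[OF wf_path_power, OF z] by simp
  next
    case False
    then have "(x, z) \<in> arcs ?P" using z Suc.prems(1) xz by (auto simp: parcs_path_power)
    from wf_digraph.gdist_arc[OF wf_path_power this] show ?thesis by simp
  qed
  ultimately have "gdist ?P x z + gdist ?P z y \<le> 1 + ereal (real m)"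
    by (intro add_mono)
  then show ?case
    using wf_digraph.gdist_triangle[OF wf_path_power, of n k x y z]
    by (auto simp: one_ereal_def add.commute intro: order_trans)
qed

text \<open>The upper and lower bounds meet at a coordinate of maximal difference. Since
  \<open>x\<close> and \<open>y\<close> are distinct, \<open>k\<close> is nonzero and such a
  coordinate exists.\<close>

lemma gdist_path_power_attained:
  assumes x: "x \<in> pverts (strong_power (path_graph n) k)"
    and y: "y \<in> pverts (strong_power (path_graph n) k)" and "x \<noteq> y"
  obtains i where "i < k"
    "gdist (with_proj (strong_power (path_graph n) k)) x y = ereal \<bar>real (x ! i) - real (y ! i)\<bar>"
proof -
  \<comment> \<open>The absolute difference is taken in the natural numbers because the upper bound
    is stated for a natural number \<open>m\<close>.\<close>
  let ?d = "\<lambda>i. if x ! i \<le> y ! i then y ! i - x ! i else x ! i - y ! i"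
  have d: "real (?d i) = \<bar>real (x ! i) - real (y ! i)\<bar>" for i
    by (auto simp: of_nat_diff)
  have "k \<noteq> 0" using assms by (auto simp: pverts_path_power)
  then have "Max (?d ` {..<k}) \<in> ?d ` {..<k}"
    by (intro Max_in) auto
  then obtain i where i: "i < k" "Max (?d ` {..<k}) = ?d i" by auto
  have "\<bar>real (x ! j) - real (y ! j)\<bar> \<le> real (?d i)" if "j < k" for j
  proof -
    have "?d j \<le> Max (?d ` {..<k})" using that by (intro Max_ge) auto
    then have "?d j \<le> ?d i" by (simp only: i(2))
    then show ?thesis by (subst d[symmetric]) (simp only: of_nat_le_iff)
  qed
  from gdist_path_power_le[OF x y this]
  have "gdist (with_proj (strong_power (path_graph n) k)) x y
    = ereal \<bar>real (x ! i) - real (y ! i)\<bar>"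
    unfolding d by (intro antisym gdist_path_power_ge i(1))
  with i(1) show thesis by (rule that)
qed

section \<open>Strong resolving sets and resolved embeddings\<close>

lemma embedding_image_simps:
  "verts (embedding_image \<phi> G P) = \<phi> ` pverts G"
  "arcs (embedding_image \<phi> G P) =
    {a \<in> parcs P. fst a \<in> \<phi> ` pverts G \<and> snd a \<in> \<phi> ` pverts G}"
  "tail (embedding_image \<phi> G P) = fst"
  "head (embedding_image \<phi> G P) = snd"
  by (simp_all add: embedding_image_def)

lemma wf_embedding_image: "wf_digraph (embedding_image \<phi> G P)"
  by unfold_locales (auto simp: embedding_image_simps)

lemma subgraph_embedding_image:
  assumes "wf_digraph (with_proj P)" "\<phi> ` pverts G \<subseteq> pverts P"
  shows "subgraph (embedding_image \<phi> G P) (with_proj P)"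
  unfolding subgraph_def compatible_def
  using assms wf_embedding_image[of \<phi> G P] by (auto simp: embedding_image_simps)

lemma strong_resolving_imp_isometric_embedding:
  fixes G H :: "'a pair_pre_digraph"
  assumes diam: "graph_diameter (with_proj G) = ereal (real D)"
    and H: "H \<in> spanning_supergraphs G"
    and sres: "strong_resolving_set (with_proj H) (set ws)"
  defines "P \<equiv> strong_power (path_graph (D + 1)) (length ws)"
  shows "\<exists>\<phi>. resolved_embedding ws \<phi> G P \<and>
    isometric_subgraph (embedding_image \<phi> G P) (with_proj P)"
proof -
  from H have bi: "pair_bidirected_digraph H" and V: "pverts H = pverts G"
    and sub: "parcs G \<subseteq> parcs H" and wfG: "wf_digraph (with_proj G)"
    by (auto simp: spanning_supergraphs_def spanning_def subgraph_def)
  interpret H: pair_bidirected_digraph H by fact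
  have wfH: "wf_digraph (with_proj H)" by unfold_locales
  have wfP: "wf_digraph (with_proj P)" unfolding P_def by (rule wf_path_power)
  let ?d = "gdist (with_proj H)"
  \<comment> \<open>Adding edges never increases distances, so the diameter of \<open>G\<close>
    bounds the distances of \<open>H\<close> as well.\<close>
  have bound: "?d x y \<le> ereal (real D)" if "x \<in> pverts G" "y \<in> pverts G" for x y
  proof -
    have "?d x y \<le> gdist (with_proj G) x y"
      by (rule gdist_hom_le[OF wfG wfH, where f = "\<lambda>x. x"]) (use V sub in auto)
    also have "\<dots> \<le> graph_diameter (with_proj G)"
      unfolding graph_diameter_def using that by (intro SUP_upper2[of "(x, y)"]) auto
    finally show ?thesis by (simp add: diam)
  qed
  \<comment> \<open>Bounded distances are lengths of walks, hence natural numbers, and can serve as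
    coordinates.\<close>
  have "\<exists>n. ?d x y = ereal (real n)" if "x \<in> pverts G" "y \<in> pverts G" for x y
    using H.gdist_attained[of x y] bound[OF that]
    by (metis ereal_infty_less(1) ereal_less_eq(1) linorder_not_le PInfty_neq_ereal(1))
  then obtain d where d: "\<And>x y. x \<in> pverts G \<Longrightarrow> y \<in> pverts G \<Longrightarrow> ?d x y = ereal (real (d x y))"
    by metis
  define \<phi> where "\<phi> x = map (\<lambda>w. d x w) ws" for x
  let ?I = "embedding_image \<phi> G P"
  have wsV: "ws ! i \<in> pverts G" if "i < length ws" for i
    using sres that V by (auto simp: strong_resolving_set_def)
  \<comment> \<open>The coordinates range over 0 to \<open>D\<close>, which is why the path has
    \<open>D + 1\<close> vertices.\<close>
  have \<phi>V: "\<phi> x \<in> pverts P" if "x \<in> pverts G" for x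
    using bound[OF that wsV] d[OF that wsV]
    by (auto simp: P_def pverts_path_power \<phi>_def less_Suc_eq_le)
  \<comment> \<open>If \<open>w\<close> strongly resolves \<open>x\<close> and \<open>y\<close>, one
    of them lies on a shortest path from the other to \<open>w\<close>, so their distances to
    \<open>w\<close> differ by the distance from \<open>x\<close> to \<open>y\<close>.\<close>
  have resolve: "\<exists>i<length ws. ?d x y \<le> ereal \<bar>real (\<phi> x ! i) - real (\<phi> y ! i)\<bar>"
    if xy: "x \<in> pverts G" "y \<in> pverts G" "x \<noteq> y" for x y
  proof -
    from sres xy have "\<exists>w \<in> set ws. strongly_resolves (with_proj H) w x y"
      unfolding strong_resolving_set_def V[symmetric] with_proj_simps by blast
    then obtain w where w: "w \<in> set ws" "strongly_resolves (with_proj H) w x y" by blast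
    then obtain i where i: "i < length ws" "w = ws ! i" by (auto simp: in_set_conv_nth)
    have wV: "w \<in> pverts G" using wsV i by simp
    have "d x y \<le> \<bar>real (d x w) - real (d y w)\<bar>"
      using w(2) H.gdist_sym[of x y] unfolding H.strongly_resolves_iff
      by (auto simp: d xy wV)
    then show ?thesis using i by (auto simp: \<phi>_def d xy)
  qed
  have inj: "inj_on \<phi> (pverts G)"
  proof (rule inj_onI, rule ccontr)
    fix x y assume xy: "x \<in> pverts G" "y \<in> pverts G" "\<phi> x = \<phi> y" "x \<noteq> y"
    then have "?d x y \<le> 0" using resolve[OF xy(1,2,4)] by (auto simp: zero_ereal_def)
    then have "d x y = 0" by (simp add: d xy zero_ereal_def)
    then have "?d x y = 0" by (simp add: d xy zero_ereal_def)
    then obtain p where "H.awalk x p y" "length p = 0"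
      using H.gdist_attained[of x y] by (auto simp: zero_ereal_def)
    then show False using xy(4) by (simp add: H.awalk_Nil_iff)
  qed
  \<comment> \<open>All arcs of \<open>H\<close> are treated, not only those of \<open>G\<close>:
    \<open>I_le\<close> needs \<open>\<phi>\<close> to be a homomorphism from \<open>H\<close> to
    its image. The triangle inequality bounds each coordinate change by 1.\<close>
  have arc: "(\<phi> x, \<phi> y) \<in> parcs P" if a: "(x, y) \<in> parcs H" for x y
  proof -
    have xy: "x \<in> pverts G" "y \<in> pverts G" "x \<noteq> y"
      using a H.in_arcsD1 H.in_arcsD2 H.no_loops' V by auto
    have "?d x y \<le> 1"
      using H.gdist_arc[of "(x, y)"] a by simp
    then have le1: "d x y \<le> 1" by (simp add: d xy one_ereal_def)
    have "d y x = d x y" using H.gdist_sym[of x y] d xy by simp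
    have "\<bar>real (d x w) - real (d y w)\<bar> \<le> 1" if "w \<in> pverts G" for w
      using H.gdist_triangle[of x w y] H.gdist_triangle[of y w x] le1 \<open>d y x = d x y\<close>
      by (auto simp: d xy that)
    moreover have "\<phi> x \<noteq> \<phi> y" using inj xy by (auto dest: inj_onD)
    ultimately show ?thesis using xy \<phi>V wsV
      unfolding P_def parcs_path_power by (auto simp: \<phi>_def)
  qed
  \<comment> \<open>The bounds \<open>I_le\<close>, \<open>P_le\<close> and \<open>le_P\<close> form
    a cycle through the distances in \<open>H\<close>, in the image and in \<open>P\<close>; hence
    all three distances agree. The link from \<open>H\<close> to \<open>P\<close> rests on a
    resolving coordinate.\<close>
  have I_le: "gdist ?I (\<phi> x) (\<phi> y) \<le> ?d x y" for x y
    by (rule gdist_hom_le[OF wfH wf_embedding_image])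
       (use arc H.in_arcsD1 H.in_arcsD2 V in \<open>force simp: embedding_image_simps\<close>)+
  have P_le: "gdist (with_proj P) u v \<le> gdist ?I u v" for u v
    by (rule gdist_hom_le[OF wf_embedding_image wfP, where f = "\<lambda>x. x"])
       (use \<phi>V in \<open>auto simp: embedding_image_simps\<close>)
  have le_P: "?d x y \<le> gdist (with_proj P) (\<phi> x) (\<phi> y)"
    if "x \<in> pverts G" "y \<in> pverts G" for x y
  proof (cases "x = y")
    case True
    then show ?thesis
      using that V \<phi>V H.gdist_self[of x] wf_digraph.gdist_self[OF wfP] by simp
  next
    case False
    from resolve[OF that this] show ?thesis
      unfolding P_def by (meson gdist_path_power_ge order_trans)
  qed
  have I_eq: "gdist ?I (\<phi> x) (\<phi> y) = ?d x y"
    and P_eq: "gdist (with_proj P) (\<phi> x) (\<phi> y) = ?d x y"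
    if "x \<in> pverts G" "y \<in> pverts G" for x y
    using I_le P_le le_P[OF that] by (metis antisym order_trans)+
  have "resolved_embedding ws \<phi> G P"
    unfolding resolved_embedding_def
  proof (intro conjI ballI)
    show "graph_embedding \<phi> G P"
      unfolding graph_embedding_def using \<phi>V inj arc sub by blast
    fix x assume x: "x \<in> pverts G"
    have "ereal (real (d x w)) = gdist ?I (\<phi> x) (\<phi> w)" if "w \<in> set ws" for w
      using that wsV x by (auto simp: in_set_conv_nth I_eq d)
    then show "map (\<lambda>n. ereal (real n)) (\<phi> x) = map (\<lambda>w. gdist ?I (\<phi> x) (\<phi> w)) ws"
      by (simp add: \<phi>_def[of x])
  qed
  moreover have "isometric_subgraph ?I (with_proj P)"
    unfolding isometric_subgraph_def
    using subgraph_embedding_image[OF wfP image_subsetI] \<phi>V I_eq P_eq by (auto simp: embedding_image_simps)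
  ultimately show ?thesis by blast
qed

text \<open>Only the maximum metric of the ambient power enters the argument, so the number
  \<open>n\<close> of path vertices is left arbitrary.\<close>

lemma isometric_embedding_imp_strong_resolving:
  fixes G :: "'a pair_pre_digraph" and n :: nat
  assumes G: "pair_bidirected_digraph G" and W: "set ws \<subseteq> pverts G"
  defines "P \<equiv> strong_power (path_graph n) (length ws)"
  assumes res: "resolved_embedding ws \<phi> G P"
    and iso: "isometric_subgraph (embedding_image \<phi> G P) (with_proj P)"
  shows "\<exists>H \<in> spanning_supergraphs G. strong_resolving_set (with_proj H) (set ws)"
proof -
  interpret G: pair_bidirected_digraph G by fact
  let ?I = "embedding_image \<phi> G P"
  \<comment> \<open>Adjacency is pulled back from \<open>P\<close>, so \<open>\<phi>\<close> becomes
    an isomorphism from \<open>H\<close> onto the induced image. Arcs of \<open>G\<close> survive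
    because \<open>\<phi>\<close> is an embedding.\<close>
  define H where "H = \<lparr> pverts = pverts G,
    parcs = {(x, y). x \<in> pverts G \<and> y \<in> pverts G \<and> (\<phi> x, \<phi> y) \<in> parcs P} \<rparr>"
  from res have \<phi>V: "\<And>x. x \<in> pverts G \<Longrightarrow> \<phi> x \<in> pverts P" and inj: "inj_on \<phi> (pverts G)"
    and arc: "\<And>x y. (x, y) \<in> parcs G \<Longrightarrow> (\<phi> x, \<phi> y) \<in> parcs P"
    by (auto simp: resolved_embedding_def graph_embedding_def)
  have HV: "pverts H = pverts G" by (simp add: H_def)
  have bi: "pair_bidirected_digraph H"
    by unfold_locales
      (auto simp: H_def P_def parcs_path_power symmetric_def abs_minus_commute intro!: symI)
  interpret H: pair_bidirected_digraph H by fact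
  have wfH: "wf_digraph (with_proj H)" by unfold_locales
  have wfG: "wf_digraph (with_proj G)" by unfold_locales
  have Hsup: "H \<in> spanning_supergraphs G"
    unfolding spanning_supergraphs_def spanning_def subgraph_def compatible_def
    using wfH wfG bi arc G.in_arcsD1 G.in_arcsD2 by (auto simp: H_def)
  let ?d = "gdist (with_proj H)"
  \<comment> \<open>The inverse of \<open>\<phi>\<close> on the image is a homomorphism back to
    \<open>H\<close>; it supplies the second of the two inequalities behind
    \<open>I_eq\<close>.\<close>
  let ?\<psi> = "the_inv_into (pverts G) \<phi>"
  have \<psi>: "?\<psi> (\<phi> x) = x" if "x \<in> pverts G" for x
    using inj that by (rule the_inv_into_f_f)
  have "gdist ?I (\<phi> x) (\<phi> y) \<le> ?d x y" for x y
    by (rule gdist_hom_le[OF wfH wf_embedding_image]) (auto simp: H_def embedding_image_simps)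
  moreover have "?d (?\<psi> u) (?\<psi> v) \<le> gdist ?I u v" for u v
    by (rule gdist_hom_le[OF wf_embedding_image wfH])
       (auto simp: H_def embedding_image_simps \<psi>)
  ultimately have I_eq: "gdist ?I (\<phi> x) (\<phi> y) = ?d x y"
    if "x \<in> pverts G" "y \<in> pverts G" for x y
    using that \<psi> by (metis antisym)
  have P_eq: "gdist (with_proj P) (\<phi> x) (\<phi> y) = ?d x y"
    if "x \<in> pverts G" "y \<in> pverts G" for x y
    using iso I_eq that by (simp add: isometric_subgraph_def embedding_image_simps)
  \<comment> \<open>Being \<open>W\<close>-resolved concerns distances in the image, which
    \<open>I_eq\<close> turns into distances in \<open>H\<close>.\<close>
  have coord: "?d x (ws ! i) = ereal (real (\<phi> x ! i))"
    if "x \<in> pverts G" "i < length ws" for x i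
  proof -
    from res that(1) have eq: "map (\<lambda>n. ereal (real n)) (\<phi> x) =
        map (\<lambda>w. gdist ?I (\<phi> x) (\<phi> w)) ws"
      by (auto simp: resolved_embedding_def)
    then have "length (\<phi> x) = length ws" by (metis length_map)
    then show ?thesis
      using that W I_eq[OF that(1), of "ws ! i"] arg_cong[OF eq, of "\<lambda>xs. xs ! i"]
      by (simp add: subset_iff)
  qed
  have "\<exists>w \<in> set ws. strongly_resolves (with_proj H) w u v"
    if uv: "u \<in> pverts G" "v \<in> pverts G" "u \<noteq> v" for u v
  proof -
    have "\<phi> u \<noteq> \<phi> v" using inj uv by (auto dest: inj_onD)
    then obtain i where i: "i < length ws"
      "gdist (with_proj P) (\<phi> u) (\<phi> v) = ereal \<bar>real (\<phi> u ! i) - real (\<phi> v ! i)\<bar>"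
      using gdist_path_power_attained \<phi>V uv(1,2) unfolding P_def by metis
    then have "?d u v = ereal \<bar>real (\<phi> u ! i) - real (\<phi> v ! i)\<bar>"
      by (simp add: P_eq uv)
    \<comment> \<open>The distance from \<open>u\<close> to \<open>v\<close> equals the absolute
      difference of their distances to \<open>ws ! i\<close>. The sign of that difference decides
      which of the two alternatives of strong resolution holds.\<close>
    then have "strongly_resolves (with_proj H) (ws ! i) u v"
      unfolding H.strongly_resolves_iff H.gdist_sym[of v u]
      by (auto simp: coord uv i)
    with i(1) show ?thesis by auto
  qed
  then have "strong_resolving_set (with_proj H) (set ws)"
    using W by (auto simp: strong_resolving_set_def HV)
  with Hsup show ?thesis by blast
qed

theorem theorem3p2:
  fixes G :: "'a pair_pre_digraph" and D k :: nat and W :: "'a set" and ws :: "'a list"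
  assumes "pair_bidirected_digraph G"
    and "connected (with_proj G)"
    and "graph_diameter (with_proj G) = ereal (real D)"
    and "W \<subseteq> pverts G"
    and "W = set ws" and "distinct ws" and "length ws = k"
  shows "(\<exists>H \<in> spanning_supergraphs G. strong_resolving_set (with_proj H) W) \<longleftrightarrow>
    (\<exists>\<phi>. resolved_embedding ws \<phi> G (strong_power (path_graph (D + 1)) k) \<and>
         isometric_subgraph (embedding_image \<phi> G (strong_power (path_graph (D + 1)) k))
           (with_proj (strong_power (path_graph (D + 1)) k)))"
  using strong_resolving_imp_isometric_embedding[OF assms(3)]
    isometric_embedding_imp_strong_resolving[OF assms(1)] assms(4,5,7)
  by metis

end
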